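(* Consider the $[pqrs]$ random walk on $\mathbb{Z}$ described in the context. The expected number of arrivals (visits) $x_n=\sum_{k=0}^\infty p_{i_0,n}^{(k)}$ in state $n\in\mathbb{Z}$ when starting in $i_0\in\mathbb{Z}$ is $$x_n=\begin{cases}\zeta_1\xi_1^{\,n-i_0}&(n\le i_0)\\ \zeta_1\xi_2^{\,n-i_0}&(n\ge i_0).\end{cases}$$ The probability $f_{ij}$ of arrival in state $j$ when starting in $i$ is $$f_{ij}=\begin{cases}\xi_1^{\,j-i}&(j<i)\\ \xi_2^{\,j-i}&(j>i)\end{cases}\qquad\text{and}\qquad f_{ii}=1-\sqrt{(1-r)^2-4pq}.$$
   Context: The walk: let $p,q,s>0$, $r\ge0$, $p+q+r+s=1$. In each state $n\in\mathbb{Z}$, at each time step the particle moves to $n+1$ with probability $p$, moves to $n-1$ with probability $q$, stays in $n$ with probability $r$, or is absorbed in $n$ (removed) with probability $s$. Here $p_{i,j}^{(k)}$ is the probability that the particle, starting in $i$ at time $0$, has not been absorbed and is in state $j$ after $k$ steps (so $p_{i,j}^{(0)}=\delta(i,j)$). The probability of arrival $f_{ij}$ is the probability that the (unabsorbed) particle, starting in $i$ at time $0$, is in state $j$ at some time $k\ge1$ (staying in a state for a step counts as an arrival there). Notation: $$\xi_1=\frac{(1-r)+\sqrt{(1-r)^2-4pq}}{2q},\quad \xi_2=\frac{(1-r)-\sqrt{(1-r)^2-4pq}}{2q},\quad \zeta_1=\left[(1-r)^2-4pq\right]^{-1/2}.$$ *)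

theory Defs
  imports "HOL-Probability.Probability"
begin

datatype move = Up | Down | Stay | Absorb

definition move_pmf :: "real \<Rightarrow> real \<Rightarrow> real \<Rightarrow> real \<Rightarrow> move pmf" where
  "move_pmf p q r s = pmf_of_list [(Up, p), (Down, q), (Stay, r), (Absorb, s)]"

text \<open>A particle is in a state \<open>Some n\<close>, or it has been absorbed (\<open>None\<close>).\<close>

fun apply_move :: "move \<Rightarrow> int option \<Rightarrow> int option" where
  "apply_move _ None = None"
| "apply_move Up (Some n) = Some (n + 1)"
| "apply_move Down (Some n) = Some (n - 1)"
| "apply_move Stay (Some n) = Some n"
| "apply_move Absorb (Some n) = None"

text \<open>
  Since the law of a move does not depend on the current state, the walk is realised on
  the space of i.i.d. sequences of moves; an absorbed particle ignores the remaining moves.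
\<close>

definition moves_space :: "real \<Rightarrow> real \<Rightarrow> real \<Rightarrow> real \<Rightarrow> move stream measure" where
  "moves_space p q r s = stream_space (measure_pmf (move_pmf p q r s))"

primrec walk :: "int \<Rightarrow> move stream \<Rightarrow> nat \<Rightarrow> int option" where
  "walk i \<omega> 0 = Some i"
| "walk i \<omega> (Suc k) = apply_move (\<omega> !! k) (walk i \<omega> k)"

definition trans_prob :: "real \<Rightarrow> real \<Rightarrow> real \<Rightarrow> real \<Rightarrow> nat \<Rightarrow> int \<Rightarrow> int \<Rightarrow> real" where
  "trans_prob p q r s k i j = \<P>(\<omega> in moves_space p q r s. walk i \<omega> k = Some j)"

text \<open>The number of visits counts time 0; an arrival has to occur at a time \<open>k \<ge> 1\<close>.\<close>

definition visits :: "int \<Rightarrow> move stream \<Rightarrow> int \<Rightarrow> ennreal" where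
  "visits i \<omega> j = emeasure (count_space UNIV) {k. walk i \<omega> k = Some j}"

definition expected_visits :: "real \<Rightarrow> real \<Rightarrow> real \<Rightarrow> real \<Rightarrow> int \<Rightarrow> int \<Rightarrow> ennreal" where
  "expected_visits p q r s i j = (\<integral>\<^sup>+ \<omega>. visits i \<omega> j \<partial>moves_space p q r s)"

definition arrival_prob :: "real \<Rightarrow> real \<Rightarrow> real \<Rightarrow> real \<Rightarrow> int \<Rightarrow> int \<Rightarrow> real" where
  "arrival_prob p q r s i j = \<P>(\<omega> in moves_space p q r s. \<exists>k\<ge>1. walk i \<omega> k = Some j)"

definition xi1 :: "real \<Rightarrow> real \<Rightarrow> real \<Rightarrow> real" where
  "xi1 p q r = ((1 - r) + sqrt ((1 - r)\<^sup>2 - 4 * p * q)) / (2 * q)"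

definition xi2 :: "real \<Rightarrow> real \<Rightarrow> real \<Rightarrow> real" where
  "xi2 p q r = ((1 - r) - sqrt ((1 - r)\<^sup>2 - 4 * p * q)) / (2 * q)"

definition zeta1 :: "real \<Rightarrow> real \<Rightarrow> real \<Rightarrow> real" where
  "zeta1 p q r = ((1 - r)\<^sup>2 - 4 * p * q) powr (- 1 / 2)"


lemma pmf_move_pmf:
  assumes "p > 0" "q > 0" "r \<ge> 0" "s > 0" "p + q + r + s = 1"
  shows "pmf (move_pmf p q r s) Up = p" "pmf (move_pmf p q r s) Down = q"
    "pmf (move_pmf p q r s) Stay = r" "pmf (move_pmf p q r s) Absorb = s"
proof -
  have "pmf_of_list_wf [(Up, p), (Down, q), (Stay, r), (Absorb, s)]"
    using assms by (auto simp: pmf_of_list_wf_def)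
  then show "pmf (move_pmf p q r s) Up = p" "pmf (move_pmf p q r s) Down = q"
    "pmf (move_pmf p q r s) Stay = r" "pmf (move_pmf p q r s) Absorb = s"
    by (simp_all add: move_pmf_def pmf_pmf_of_list)
qed

lemma prob_space_moves_space: "prob_space (moves_space p q r s)"
  unfolding moves_space_def
  by (rule prob_space.prob_space_stream_space) (rule prob_space_measure_pmf)

lemma space_moves_space [simp]: "space (moves_space p q r s) = UNIV"
  by (simp add: moves_space_def space_stream_space)

lemma measurable_walk [measurable]:
  "(\<lambda>\<omega>. walk i \<omega> k) \<in> moves_space p q r s \<rightarrow>\<^sub>M count_space UNIV"
proof (induction k)
  case 0
  then show ?case by simp
next
  case (Suc k)
  have nth: "(\<lambda>\<omega>. \<omega> !! k) \<in> moves_space p q r s \<rightarrow>\<^sub>M count_space UNIV"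
    unfolding moves_space_def
    by (rule measurable_compose[OF measurable_snth]) simp
  have "(\<lambda>\<omega>. apply_move (\<omega> !! k) (walk i \<omega> k)) \<in> moves_space p q r s \<rightarrow>\<^sub>M count_space UNIV"
    by (rule measurable_compose_countable'[where I = UNIV and g = "\<lambda>\<omega>. walk i \<omega> k"])
       (use Suc in \<open>auto intro: measurable_compose[OF nth]\<close>)
  then show ?case by simp
qed

lemma trans_prob_0: "trans_prob p q r s 0 i j = (if i = j then 1 else 0)"
  using prob_space.prob_space[OF prob_space_moves_space, of p q r s]
  by (simp add: trans_prob_def)

end

theory Submission
  imports Defs
begin

text \<open>
  Both quantities are obtained from one first-step analysis. Conditioning on the first move turns
  the expected number of visits to \<open>j\<close>, and also the probability of ever being in \<open>j\<close>, into a function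
  \<open>u\<close> of the starting state that satisfies \<open>u i = p * u (i + 1) + q * u (i - 1) + r * u i\<close> away
  from \<open>j\<close>. Absorption makes the right-hand side a contraction with factor \<open>1 - s\<close> in the
  supremum norm, so a \<^emph>\<open>bounded\<close> solution is determined by what happens at \<open>j\<close>
  (\<open>bounded_harmonic_eq_0\<close>). It therefore suffices to exhibit one.

  The powers \<open>\<xi> powi (j - i)\<close> solve the equation exactly if \<open>\<xi>\<close> is a root of
  \<open>q * x\<^sup>2 - (1 - r) * x + p\<close>, that is, \<open>xi1\<close> or \<open>xi2\<close>. At \<open>x = 1\<close> this polynomial has the value \<open>- s < 0\<close>,
  so that \<open>0 < xi2 < 1 < xi1\<close>: the bounded solution must use \<open>xi1\<close> for \<open>j \<le> i\<close> and \<open>xi2\<close> for \<open>i \<le> j\<close>.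
  The result of one step from the peak of this profile is
  \<open>p / xi1 + q * xi2 + r = 1 - sqrt ((1 - r)\<^sup>2 - 4 * p * q)\<close>. This number is the return
  probability, and its distance \<open>1 / zeta1\<close> from 1 says by which factor the profile has to be
  scaled to become the expected number of visits, whose equation at \<open>j\<close> has the extra term 1 for
  the visit at time 0. That the expected number of visits is bounded follows from
  \<open>trans_prob p q r s k i j \<le> (1 - s) ^ k\<close>.
\<close>

section \<open>First-step analysis of the walk\<close>

locale absorbed_walk =
  fixes p q r s :: real
  assumes p_pos: "p > 0" and q_pos: "q > 0" and r_nonneg: "r \<ge> 0" and s_pos: "s > 0"
    and total: "p + q + r + s = 1"
begin

text \<open>In an i.i.d. sequence the moves after the first one are distributed like the whole sequence.\<close>

lemma prob_first_step:
  assumes "{\<omega>. P \<omega>} \<in> sets (moves_space p q r s)"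
  shows "\<P>(\<omega> in moves_space p q r s. P \<omega>) =
     p * \<P>(\<omega> in moves_space p q r s. P (Up ## \<omega>)) + q * \<P>(\<omega> in moves_space p q r s. P (Down ## \<omega>)) +
     r * \<P>(\<omega> in moves_space p q r s. P (Stay ## \<omega>)) + s * \<P>(\<omega> in moves_space p q r s. P (Absorb ## \<omega>))"
proof -
  let ?Q = "\<lambda>m. \<P>(\<omega> in moves_space p q r s. P (m ## \<omega>))"
  have UNIV_move: "(UNIV :: move set) = {Up, Down, Stay, Absorb}"
    using move.exhaust by auto
  then have "finite (UNIV :: move set)"
    by (metis finite.emptyI finite.insertI)
  note pmf = pmf_move_pmf[OF p_pos q_pos r_nonneg s_pos total]
  have "ennreal (\<P>(\<omega> in moves_space p q r s. P \<omega>)) =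
      (\<integral>\<^sup>+m. ennreal (?Q m) \<partial>measure_pmf (move_pmf p q r s))"
    using prob_space.prob_stream_space[OF prob_space_measure_pmf, of "move_pmf p q r s" P] assms by (simp add: moves_space_def space_stream_space)
  also have "\<dots> = (\<Sum>m\<in>UNIV. ennreal (?Q m) * ennreal (pmf (move_pmf p q r s) m))"
    by (rule nn_integral_measure_pmf_support) (use \<open>finite (UNIV :: move set)\<close> in simp_all)
  also have "\<dots> = (\<Sum>m\<in>UNIV. ennreal (?Q m * pmf (move_pmf p q r s) m))"
    by (simp add: ennreal_mult)
  also have "\<dots> = ennreal (\<Sum>m\<in>UNIV. ?Q m * pmf (move_pmf p q r s) m)"
    by (rule sum_ennreal) simp
  finally have "\<P>(\<omega> in moves_space p q r s. P \<omega>) = (\<Sum>m\<in>UNIV. ?Q m * pmf (move_pmf p q r s) m)"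
    by (subst (asm) ennreal_inj) (auto intro!: sum_nonneg)
  then show ?thesis
    by (simp add: UNIV_move pmf mult.commute)
qed

lemma sets_walk [measurable]: "{\<omega>. walk i \<omega> k = Some j} \<in> sets (moves_space p q r s)"
  using measurable_sets[OF measurable_walk[of i k p q r s], of "{Some j}"]
  by (simp add: vimage_def)

end

text \<open>
  The walk is defined by recursion on its last move. This splits off the first move instead, as
  the first-step equations require.
\<close>

lemma walk_Stream:
  "walk i (m ## \<omega>) (Suc k) =
     (case apply_move m (Some i) of None \<Rightarrow> None | Some i' \<Rightarrow> walk i' \<omega> k)"
  by (induction k) (auto split: option.split)

text \<open>
  Unlike an arrival, a hit may occur at time 0. After the first step this is the right notion:
  an arrival at a time \<open>k \<ge> 1\<close> is a hit at time \<open>k - 1\<close> of the walk that starts after that step.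
\<close>

definition hit_prob :: "real \<Rightarrow> real \<Rightarrow> real \<Rightarrow> real \<Rightarrow> int \<Rightarrow> int \<Rightarrow> real" where
  "hit_prob p q r s i j = \<P>(\<omega> in moves_space p q r s. \<exists>k. walk i \<omega> k = Some j)"

lemma hit_prob_self: "hit_prob p q r s j j = 1"
proof -
  have "\<exists>k. walk j \<omega> k = Some j" for \<omega>
    by (rule exI[of _ 0]) simp
  then show ?thesis
    using prob_space.prob_space[OF prob_space_moves_space, of p q r s]
    by (simp add: hit_prob_def)
qed

lemma hit_prob_eq_arrival_prob:
  assumes "i \<noteq> j"
  shows "hit_prob p q r s i j = arrival_prob p q r s i j"
proof -
  have "(\<exists>k. walk i \<omega> k = Some j) \<longleftrightarrow> (\<exists>k\<ge>1. walk i \<omega> k = Some j)" for \<omega>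
    using assms by (metis One_nat_def Suc_leI neq0_conv option.inject walk.simps(1))
  then show ?thesis by (simp add: hit_prob_def arrival_prob_def)
qed

context absorbed_walk
begin

lemma trans_prob_Suc:
  "trans_prob p q r s (Suc k) i j = p * trans_prob p q r s k (i + 1) j +
     q * trans_prob p q r s k (i - 1) j + r * trans_prob p q r s k i j"
  unfolding trans_prob_def
  by (subst prob_first_step[OF sets_walk]) (simp add: walk_Stream del: walk.simps)

lemma arrival_prob_first_step:
  "arrival_prob p q r s i j =
     p * hit_prob p q r s (i + 1) j + q * hit_prob p q r s (i - 1) j + r * hit_prob p q r s i j"
proof -
  have "{\<omega>. \<exists>k. walk i \<omega> (Suc k) = Some j} = (\<Union>k. {\<omega>. walk i \<omega> (Suc k) = Some j})"
    by auto
  also have "\<dots> \<in> sets (moves_space p q r s)"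
    using sets_walk by blast
  finally have sets: "{\<omega>. \<exists>k. walk i \<omega> (Suc k) = Some j} \<in> sets (moves_space p q r s)" .
  have Suc: "(\<exists>k\<ge>1. walk i \<omega> k = Some j) \<longleftrightarrow> (\<exists>k. walk i \<omega> (Suc k) = Some j)" for \<omega>
    by (metis One_nat_def Suc_le_D le_add1 plus_1_eq_Suc)
  then show ?thesis
    unfolding arrival_prob_def hit_prob_def Suc
    by (subst prob_first_step[OF sets]) (simp add: walk_Stream del: walk.simps)
qed

section \<open>Uniqueness of bounded solutions\<close>

text \<open>
  One application of the equation improves a bound \<open>C\<close> on \<open>\<bar>d\<bar>\<close> to \<open>(1 - s) * C\<close>. Where \<open>d\<close>
  vanishes this holds anyway, which is why the equation is only required elsewhere: probabilities
  of a hit violate the equation at the target state, but there they are known to be 1.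
\<close>

lemma bounded_harmonic_eq_0:
  assumes bounded: "\<And>i. \<bar>d i\<bar> \<le> B"
    and harmonic: "\<And>i. d i \<noteq> 0 \<Longrightarrow> d i = p * d (i + 1) + q * d (i - 1) + r * d i"
  shows "d (i :: int) = 0"
proof -
  have bound: "\<bar>d i\<bar> \<le> (1 - s) ^ n * B" for n i
  proof (induction n arbitrary: i)
    case 0
    then show ?case using bounded by simp
  next
    case (Suc n)
    show ?case
    proof (cases "d i = 0")
      case True
      have "0 \<le> B" using bounded[of i] by linarith
      then show ?thesis
        using True p_pos q_pos r_nonneg total by simp
    next
      case False
      have "\<bar>d i\<bar> = \<bar>p * d (i + 1) + q * d (i - 1) + r * d i\<bar>"
        using harmonic[OF False] by simp
      also have "\<dots> \<le> \<bar>p * d (i + 1)\<bar> + \<bar>q * d (i - 1)\<bar> + \<bar>r * d i\<bar>"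
        by linarith
      also have "\<dots> = p * \<bar>d (i + 1)\<bar> + q * \<bar>d (i - 1)\<bar> + r * \<bar>d i\<bar>"
        using p_pos q_pos r_nonneg by (simp add: abs_mult)
      also have "\<dots> \<le> p * ((1 - s) ^ n * B) + q * ((1 - s) ^ n * B) + r * ((1 - s) ^ n * B)"
        using p_pos q_pos r_nonneg by (intro add_mono mult_left_mono Suc) auto
      also have "\<dots> = (p + q + r) * ((1 - s) ^ n * B)"
        by (simp add: algebra_simps)
      also have "p + q + r = 1 - s"
        using total by simp
      finally show ?thesis by simp
    qed
  qed
  have "(\<lambda>n. (1 - s) ^ n * B) \<longlonglongrightarrow> 0"
    by (rule tendsto_mult_left_zero, rule LIMSEQ_realpow_zero)
       (use p_pos q_pos r_nonneg s_pos total in auto)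
  then have "\<bar>d i\<bar> \<le> 0"
    using bound[of i] by (intro tendsto_lowerbound[where f = "\<lambda>n. (1 - s) ^ n * B"]) auto
  then show ?thesis by simp
qed

section \<open>The explicit bounded solution\<close>

lemma discriminant_pos: "(1 - r)\<^sup>2 - 4 * p * q > 0"
proof -
  have "(1 - r)\<^sup>2 > (p + q)\<^sup>2"
    using p_pos q_pos s_pos total by (intro power_strict_mono) auto
  moreover have "(p + q)\<^sup>2 - 4 * p * q = (p - q)\<^sup>2"
    by (simp add: power2_eq_square algebra_simps)
  ultimately show ?thesis
    using zero_le_power2[of "p - q"] by linarith
qed

text \<open>
  Divided by \<open>x\<close>, the characteristic equation reads \<open>p / x + q * x = 1 - r\<close>. The third identity is
  Vieta's formula \<open>xi1 * xi2 = p / q\<close>.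
\<close>

lemma xi_roots:
  "p / xi1 p q r + q * xi1 p q r = 1 - r" "p / xi2 p q r + q * xi2 p q r = 1 - r"
  "p / xi1 p q r = q * xi2 p q r"
  and xi_bounds: "xi1 p q r > 1" "xi2 p q r > 0" "xi2 p q r < 1"
proof -
  define D where "D = sqrt ((1 - r)\<^sup>2 - 4 * p * q)"
  have D2: "D\<^sup>2 = (1 - r)\<^sup>2 - 4 * p * q"
    unfolding D_def using discriminant_pos by (intro real_sqrt_pow2) simp
  have D_nonneg: "D \<ge> 0"
    unfolding D_def using discriminant_pos by (intro real_sqrt_ge_zero) simp
  have x1: "2 * q * xi1 p q r = 1 - r + D" and x2: "2 * q * xi2 p q r = 1 - r - D"
    using q_pos by (simp_all add: xi1_def xi2_def D_def)
  have "D\<^sup>2 < (1 - r)\<^sup>2"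
    using D2 p_pos q_pos by simp
  then have D_less: "D < 1 - r"
    using p_pos q_pos s_pos total by (intro power2_less_imp_less[of D]) auto
  \<comment> \<open>The next two bounds say that 1 lies strictly between the roots; they come from
      \<open>D\<^sup>2 = (p - q + s)\<^sup>2 + 4 * q * s\<close>.\<close>
  have r: "1 - r = p + q + s" using total by simp
  have "(p - q + s)\<^sup>2 < D\<^sup>2" "(q - p - s)\<^sup>2 < D\<^sup>2"
    unfolding D2 r using q_pos s_pos by (simp_all add: power2_eq_square algebra_simps)
  then have D_greater: "p - q + s < D" "q - p - s < D"
    using D_nonneg by (blast intro: power2_less_imp_less)+
  have "2 * q * xi1 p q r > 2 * q * 1"
    unfolding x1 using D_greater r by simp
  then show gt1: "xi1 p q r > 1"
    by (rule mult_left_less_imp_less) (use q_pos in simp)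
  have "2 * q * xi2 p q r > 2 * q * 0"
    unfolding x2 using D_less by simp
  then show pos: "xi2 p q r > 0"
    by (rule mult_left_less_imp_less) (use q_pos in simp)
  have "2 * q * xi2 p q r < 2 * q * 1"
    unfolding x2 using D_greater r by simp
  then show "xi2 p q r < 1"
    by (rule mult_left_less_imp_less) (use q_pos in simp)
  have "4 * q * (q * (xi1 p q r * xi2 p q r)) = (2 * q * xi1 p q r) * (2 * q * xi2 p q r)"
    by simp
  also have "\<dots> = (1 - r)\<^sup>2 - D\<^sup>2"
    unfolding x1 x2 by (simp add: power2_eq_square algebra_simps)
  also have "\<dots> = 4 * q * p"
    by (simp add: D2)
  finally have prod: "q * (xi1 p q r * xi2 p q r) = p"
    using q_pos by simp
  show "p / xi1 p q r = q * xi2 p q r"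
    using gt1 prod by (simp add: field_simps)
  moreover have "p / xi2 p q r = q * xi1 p q r"
    using pos prod by (simp add: field_simps)
  ultimately show "p / xi1 p q r + q * xi1 p q r = 1 - r" "p / xi2 p q r + q * xi2 p q r = 1 - r"
    using x1 x2 by linarith+
qed

end

text \<open>
  The argument is the displacement from the starting state to the target. On either side the root
  is the one whose powers decay with the distance.
\<close>

definition two_sided_power :: "real \<Rightarrow> real \<Rightarrow> real \<Rightarrow> int \<Rightarrow> real" where
  "two_sided_power p q r n = (if n \<le> 0 then xi1 p q r powi n else xi2 p q r powi n)"

lemma two_sided_power_nonneg_arg: "n \<ge> 0 \<Longrightarrow> two_sided_power p q r n = xi2 p q r powi n"
  by (cases "n = 0") (auto simp: two_sided_power_def)

context absorbed_walk
begin

lemma two_sided_power_bounds: "0 \<le> two_sided_power p q r n" "two_sided_power p q r n \<le> 1"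
proof -
  have "xi1 p q r powi n \<le> 1" if "n \<le> 0"
    using power_int_le_one[of "inverse (xi1 p q r)" "- n"] xi_bounds(1) that
    by (simp add: power_int_minus power_int_inverse inverse_le_1_iff)
  then show "0 \<le> two_sided_power p q r n" "two_sided_power p q r n \<le> 1"
    using xi_bounds by (auto simp: two_sided_power_def intro: power_int_le_one)
qed

lemma two_sided_power_harmonic:
  assumes "i \<noteq> j"
  shows "two_sided_power p q r (j - i) =
    p * two_sided_power p q r (j - (i + 1)) + q * two_sided_power p q r (j - (i - 1)) +
    r * two_sided_power p q r (j - i)"
proof -
  define n where "n = j - i"
  have n: "n \<noteq> 0" "j - (i + 1) = n - 1" "j - (i - 1) = n + 1"
    using assms by (auto simp: n_def)
  have power: "x powi n = p * x powi (n - 1) + q * x powi (n + 1) + r * x powi n"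
    if "x > 0" "p / x + q * x = 1 - r" for x
  proof -
    have "p * x powi (n - 1) + q * x powi (n + 1) = (p / x + q * x) * x powi n"
      using that(1) by (simp add: power_int_diff power_int_add field_simps)
    also have "\<dots> = (1 - r) * x powi n"
      by (simp only: that(2))
    finally show ?thesis by (simp add: algebra_simps)
  qed
  show ?thesis
  proof (cases "n < 0")
    case True
    then show ?thesis
      unfolding n(2,3) n_def[symmetric]
      using power[of "xi1 p q r"] xi_roots xi_bounds by (simp add: two_sided_power_def)
  next
    case False
    then show ?thesis
      unfolding n(2,3) n_def[symmetric]
      using n(1) power[of "xi2 p q r"] xi_roots xi_bounds
      by (simp add: two_sided_power_nonneg_arg)
  qed
qed

text \<open>This is where the square root enters: \<open>p / xi1 = q * xi2\<close>, and \<open>2 * q * xi2 = 1 - r - sqrt \<dots>\<close>.\<close>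

lemma two_sided_power_step_at_0:
  "p * two_sided_power p q r (- 1) + q * two_sided_power p q r 1 + r =
     1 - sqrt ((1 - r)\<^sup>2 - 4 * p * q)"
proof -
  have "p * two_sided_power p q r (- 1) + q * two_sided_power p q r 1 = 2 * q * xi2 p q r"
    using xi_roots(3) by (simp add: two_sided_power_def power_int_minus divide_inverse)
  also have "\<dots> = 1 - r - sqrt ((1 - r)\<^sup>2 - 4 * p * q)"
    using q_pos by (simp add: xi2_def)
  finally show ?thesis by simp
qed

section \<open>Arrival probabilities and expected visits\<close>

lemma hit_prob_eq: "hit_prob p q r s i j = two_sided_power p q r (j - i)"
proof -
  define d where "d i = hit_prob p q r s i j - two_sided_power p q r (j - i)" for i
  have "d i = 0"
  proof (rule bounded_harmonic_eq_0)
    fix i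
    have "0 \<le> hit_prob p q r s i j" "hit_prob p q r s i j \<le> 1"
      by (auto simp: hit_prob_def prob_space.prob_le_1[OF prob_space_moves_space])
    then show "\<bar>d i\<bar> \<le> 1"
      using two_sided_power_bounds[of "j - i"] by (simp add: d_def abs_le_iff)
    assume "d i \<noteq> 0"
    then have "i \<noteq> j"
      by (auto simp: d_def hit_prob_self two_sided_power_def)
    then have "hit_prob p q r s i j =
        p * hit_prob p q r s (i + 1) j + q * hit_prob p q r s (i - 1) j + r * hit_prob p q r s i j"
      using hit_prob_eq_arrival_prob[of i j p q r s] arrival_prob_first_step[of i j] by simp
    with two_sided_power_harmonic[OF \<open>i \<noteq> j\<close>]
    show "d i = p * d (i + 1) + q * d (i - 1) + r * d i"
      unfolding d_def right_diff_distrib by linarith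
  qed
  then show ?thesis by (simp add: d_def)
qed

lemma arrival_prob_self: "arrival_prob p q r s i i = 1 - sqrt ((1 - r)\<^sup>2 - 4 * p * q)"
  using two_sided_power_step_at_0
  by (simp add: arrival_prob_first_step hit_prob_eq two_sided_power_def)

text \<open>A particle that is in \<open>j\<close> at time \<open>k\<close> has survived \<open>k\<close> steps.\<close>

lemma trans_prob_le: "trans_prob p q r s k i j \<le> (1 - s) ^ k"
proof (induction k arbitrary: i)
  case 0
  then show ?case by (simp add: trans_prob_0)
next
  case (Suc k)
  have "trans_prob p q r s (Suc k) i j \<le> p * (1 - s) ^ k + q * (1 - s) ^ k + r * (1 - s) ^ k"
    unfolding trans_prob_Suc
    using p_pos q_pos r_nonneg by (intro add_mono mult_left_mono Suc) auto
  also have "\<dots> = (p + q + r) * (1 - s) ^ k"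
    by (simp add: algebra_simps)
  also have "p + q + r = 1 - s"
    using total by simp
  finally show ?case by simp
qed

lemma trans_prob_nonneg: "0 \<le> trans_prob p q r s k i j"
  by (simp add: trans_prob_def)

lemma survival_sums: "(\<lambda>k. (1 - s) ^ k) sums (1 / s)"
  using geometric_sums[of "1 - s"] p_pos q_pos r_nonneg s_pos total by simp

lemma summable_trans_prob: "summable (\<lambda>k. trans_prob p q r s k i j)"
  by (rule summable_comparison_test'[OF sums_summable[OF survival_sums], of 0])
     (simp add: trans_prob_nonneg trans_prob_le)

text \<open>
  Splitting off \<open>k = 0\<close> turns the one-step recursion of the transition probabilities into the
  equation of \<open>hit_prob\<close>, but now with the source term 1 at \<open>i = j\<close>. Subtracting the scaled profile,
  which has the same source, leaves a bounded solution without source.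
\<close>

lemma suminf_trans_prob:
  "(\<Sum>k. trans_prob p q r s k i j) = zeta1 p q r * two_sided_power p q r (j - i)"
proof -
  define D where "D = sqrt ((1 - r)\<^sup>2 - 4 * p * q)"
  have D_pos: "D > 0"
    using discriminant_pos by (simp add: D_def)
  have zeta: "zeta1 p q r = 1 / D"
    using discriminant_pos
    by (simp add: zeta1_def D_def powr_minus_divide powr_half_sqrt)
  define G where "G i = (\<Sum>k. trans_prob p q r s k i j)" for i
  have G_step: "G i = (if i = j then 1 else 0) + (p * G (i + 1) + q * G (i - 1) + r * G i)" for i
  proof -
    have "G i = trans_prob p q r s 0 i j + (\<Sum>k. trans_prob p q r s (Suc k) i j)"
      unfolding G_def by (subst suminf_split_head[OF summable_trans_prob]) simp
    also have "(\<Sum>k. trans_prob p q r s (Suc k) i j) = p * G (i + 1) + q * G (i - 1) + r * G i"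
      unfolding trans_prob_Suc G_def
      by (intro sums_unique[symmetric] sums_add sums_mult summable_sums summable_trans_prob)
    finally show ?thesis by (simp add: trans_prob_0)
  qed
  define d where "d i = G i - two_sided_power p q r (j - i) / D" for i
  have "d i = 0"
  proof (rule bounded_harmonic_eq_0)
    fix i
    have "G i \<le> 1 / s"
      unfolding G_def sums_unique[OF survival_sums]
      by (rule suminf_le[OF trans_prob_le summable_trans_prob sums_summable[OF survival_sums]])
    moreover have "0 \<le> G i"
      unfolding G_def by (rule suminf_nonneg[OF summable_trans_prob trans_prob_nonneg])
    moreover have "0 \<le> two_sided_power p q r (j - i) / D" "two_sided_power p q r (j - i) / D \<le> 1 / D"
      using two_sided_power_bounds[of "j - i"] D_pos by (auto intro: divide_right_mono)
    ultimately show "\<bar>d i\<bar> \<le> 1 / s + 1 / D"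
      unfolding d_def by linarith
    have D_div: "(if i = j then D else 0) / D = (if i = j then 1 else 0)"
      using D_pos by simp
    \<comment> \<open>At \<open>i = j\<close> the profile loses \<open>D\<close> in one step, which after scaling by \<open>1 / D\<close> is
        the 1 contributed by time 0.\<close>
    have "two_sided_power p q r (j - i) = (if i = j then D else 0) +
        (p * two_sided_power p q r (j - (i + 1)) + q * two_sided_power p q r (j - (i - 1)) +
         r * two_sided_power p q r (j - i))"
    proof (cases "i = j")
      case True
      then show ?thesis
        using two_sided_power_step_at_0 by (simp add: D_def two_sided_power_def)
    next
      case False
      then show ?thesis
        using two_sided_power_harmonic[of i j] by simp
    qed
    from arg_cong[OF this, of "\<lambda>x. x / D"] D_div
    have "two_sided_power p q r (j - i) / D = (if i = j then 1 else 0) +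
        (p * (two_sided_power p q r (j - (i + 1)) / D) + q * (two_sided_power p q r (j - (i - 1)) / D) +
         r * (two_sided_power p q r (j - i) / D))"
      unfolding add_divide_distrib times_divide_eq_right by linarith
    with G_step[of i] show "d i = p * d (i + 1) + q * d (i - 1) + r * d i"
      unfolding d_def right_diff_distrib by linarith
  qed
  then show ?thesis
    by (simp add: d_def G_def zeta)
qed

lemma sums_trans_prob:
  "(\<lambda>k. trans_prob p q r s k i j) sums (zeta1 p q r * two_sided_power p q r (j - i))"
  using summable_sums[OF summable_trans_prob] by (simp add: suminf_trans_prob)

lemma expected_visits_eq_suminf:
  "expected_visits p q r s i j = ennreal (\<Sum>k. trans_prob p q r s k i j)"
proof -
  interpret prob_space "moves_space p q r s" by (rule prob_space_moves_space)
  have visits: "visits i \<omega> j = (\<Sum>k. indicator {\<omega>. walk i \<omega> k = Some j} \<omega>)" for \<omega>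
  proof -
    have "visits i \<omega> j = (\<integral>\<^sup>+k. indicator {k. walk i \<omega> k = Some j} k \<partial>count_space UNIV)"
      by (simp add: visits_def)
    also have "\<dots> = (\<Sum>k. indicator {k. walk i \<omega> k = Some j} k)"
      by (rule nn_integral_count_space_nat)
    finally show ?thesis by (simp add: indicator_def)
  qed
  have "expected_visits p q r s i j =
      (\<Sum>k. \<integral>\<^sup>+\<omega>. indicator {\<omega>. walk i \<omega> k = Some j} \<omega> \<partial>moves_space p q r s)"
    unfolding expected_visits_def visits by (rule nn_integral_suminf) simp
  also have "\<dots> = (\<Sum>k. ennreal (trans_prob p q r s k i j))"
    by (simp add: trans_prob_def emeasure_eq_measure)
  also have "\<dots> = ennreal (\<Sum>k. trans_prob p q r s k i j)"
    by (rule suminf_ennreal2[OF trans_prob_nonneg summable_trans_prob])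
  finally show ?thesis .
qed

end

theorem theorem8:
  fixes p q r s :: real
  assumes "p > 0" and "q > 0" and "s > 0" and "r \<ge> 0" and "p + q + r + s = 1"
  shows
    "(\<forall>i0 n :: int.
        (n \<le> i0 \<longrightarrow>
          (\<lambda>k. trans_prob p q r s k i0 n) sums (zeta1 p q r * xi1 p q r powi (n - i0)) \<and>
          expected_visits p q r s i0 n = ennreal (zeta1 p q r * xi1 p q r powi (n - i0))) \<and>
        (n \<ge> i0 \<longrightarrow>
          (\<lambda>k. trans_prob p q r s k i0 n) sums (zeta1 p q r * xi2 p q r powi (n - i0)) \<and>
          expected_visits p q r s i0 n = ennreal (zeta1 p q r * xi2 p q r powi (n - i0)))) \<and>
     (\<forall>i j :: int.
        (j < i \<longrightarrow> arrival_prob p q r s i j = xi1 p q r powi (j - i)) \<and>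
        (j > i \<longrightarrow> arrival_prob p q r s i j = xi2 p q r powi (j - i))) \<and>
     (\<forall>i :: int. arrival_prob p q r s i i = 1 - sqrt ((1 - r)\<^sup>2 - 4 * p * q))"
proof -
  interpret absorbed_walk p q r s
    using assms by unfold_locales
  have visits: "expected_visits p q r s i j = ennreal (zeta1 p q r * two_sided_power p q r (j - i))" for i j
    by (simp add: expected_visits_eq_suminf suminf_trans_prob)
  have arrival: "arrival_prob p q r s i j = two_sided_power p q r (j - i)" if "i \<noteq> j" for i j
    using that by (simp flip: hit_prob_eq_arrival_prob add: hit_prob_eq)
  show ?thesis
  proof (intro conjI allI impI)
    fix i n :: int
    assume "n \<le> i"
    then have "two_sided_power p q r (n - i) = xi1 p q r powi (n - i)"
      by (simp add: two_sided_power_def)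
    then show "(\<lambda>k. trans_prob p q r s k i n) sums (zeta1 p q r * xi1 p q r powi (n - i))"
      and "expected_visits p q r s i n = ennreal (zeta1 p q r * xi1 p q r powi (n - i))"
      using sums_trans_prob[of i n] visits[of i n] by simp_all
  next
    fix i n :: int
    assume "n \<ge> i"
    then have "two_sided_power p q r (n - i) = xi2 p q r powi (n - i)"
      by (simp add: two_sided_power_nonneg_arg)
    then show "(\<lambda>k. trans_prob p q r s k i n) sums (zeta1 p q r * xi2 p q r powi (n - i))"
      and "expected_visits p q r s i n = ennreal (zeta1 p q r * xi2 p q r powi (n - i))"
      using sums_trans_prob[of i n] visits[of i n] by simp_all
  next
    fix i j :: int
    assume "j < i"
    then show "arrival_prob p q r s i j = xi1 p q r powi (j - i)"
      using arrival[of i j] by (simp add: two_sided_power_def)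
  next
    fix i j :: int
    assume "j > i"
    then show "arrival_prob p q r s i j = xi2 p q r powi (j - i)"
      using arrival[of i j] by (simp add: two_sided_power_nonneg_arg)
  next
    fix i :: int
    show "arrival_prob p q r s i i = 1 - sqrt ((1 - r)\<^sup>2 - 4 * p * q)"
      by (rule arrival_prob_self)
  qed
qed

end
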